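(* Let $A\in\mathbb{R}^{m\times n}$ have no zero row and no zero column, and let $C\in\mathbb{R}^{p\times n}$. Let $X^{(0)}\in\mathbb{R}^{p\times m}$ satisfy $(X^{(0)}_{i,:})^T\in R(A)$ for $i=1,\dots,p$, let $Y^{(0)}\in\mathbb{R}^{p\times m}$ be arbitrary, $R^{(0)}=C-Y^{(0)}A$, and for $k\ge0$ let $$U^{(k)}=\frac{R^{(k)}(A_{i,:})^T}{\|A_{i,:}\|_2^2},\qquad Y^{(k+1)}_{:,i}=Y^{(k)}_{:,i}+U^{(k)},\qquad R^{(k+1)}=R^{(k)}-U^{(k)}A_{i,:},$$ (all columns of $Y^{(k)}$ other than the $i$th being left unchanged) and $$X^{(k+1)}=X^{(k)}-\frac{(X^{(k)}-Y^{(k+1)})A_{:,j}}{\|A_{:,j}\|_2^2}(A_{:,j})^T,$$ where at each iteration the row index $i$ and the column index $j$ of $A$ are selected at random with probabilities $\|A_{i,:}\|_2^2/\|A\|_F^2$ and $\|A_{:,j}\|_2^2/\|A\|_F^2$, respectively. Then $\{X^{(k)}\}$ converges linearly in mean square to $CA^+$, and for all $k\ge0$ $$E\bigl[\|X^{(k+1)}-CA^+\|_F^2\bigr]\le\frac{(k+1)\rho^{k+1}}{\|A\|_F^2}\|Y^{(0)}A-CA^+A\|_F^2+\rho^{k+1}\|X^{(0)}-CA^+\|_F^2,$$ where $\rho=1-\dfrac{\sigma_{\min}^2(A)}{\|A\|_F^2}$.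
   Context: $A_{i,:}$ and $A_{:,j}$ denote the $i$th row and $j$th column of $A$, $R(A)$ the column space of $A$ (not to be confused with the residual matrices $R^{(k)}$), $A^+$ the Moore-Penrose inverse, $\|\cdot\|_F$ the Frobenius norm, and $\sigma_{\min}(A)$ the smallest nonzero singular value of $A$. $A$ may be rank deficient and $XA=C$ may be inconsistent. All index selections (row and column, and over different iterations) are independent. "Converges linearly in mean square to $X^*$" means that $E[\|X^{(k)}-X^*\|_F^2]\to 0$ at a geometric rate (bounded by $c\,q^k$ for some $c\ge 0$ and $q\in[0,1)$). *)

theory Defs
  imports "HOL-Probability.Probability"
begin

text \<open>
  An \<open>m \<times> n\<close> matrix has type \<open>real ^ 'n ^ 'm\<close>. The library's \<^const>\<open>norm\<close> on that type is the
  Euclidean norm of all entries, i.e. the Frobenius norm, and on vectors it is the 2-norm.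
\<close>

text \<open>The four Penrose conditions; they determine \<open>B\<close> uniquely.\<close>

definition is_moore_penrose :: "real ^ 'n ^ 'm \<Rightarrow> real ^ 'm ^ 'n \<Rightarrow> bool" where
  "is_moore_penrose A B \<longleftrightarrow>
     A ** B ** A = A \<and> B ** A ** B = B \<and>
     transpose (A ** B) = A ** B \<and> transpose (B ** A) = B ** A"

definition moore_penrose :: "real ^ 'n ^ 'm \<Rightarrow> real ^ 'm ^ 'n" where
  "moore_penrose A = (THE B. is_moore_penrose A B)"

text \<open>
  The singular values are the nonnegative square roots of the eigenvalues of \<open>A\<^sup>T A\<close>; using
  \<open>A A\<^sup>T\<close> instead can only change whether 0 is among them.
\<close>

definition singular_values :: "real ^ 'n ^ 'm \<Rightarrow> real set" where
  "singular_values A =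
     {s. s \<ge> 0 \<and> (\<exists>v. v \<noteq> 0 \<and> (transpose A ** A) *v v = s\<^sup>2 *\<^sub>R v)}"

text \<open>Meaningful for \<open>A \<noteq> 0\<close> only: the zero matrix has no nonzero singular value.\<close>

definition sigma_min :: "real ^ 'n ^ 'm \<Rightarrow> real" where
  "sigma_min A = Min (singular_values A - {0})"

text \<open>\<open>u v\<^sup>T\<close>\<close>

definition outer :: "real ^ 'p \<Rightarrow> real ^ 'n \<Rightarrow> real ^ 'n ^ 'p" where
  "outer u v = (\<chi> r c. u $ r * v $ c)"

definition add_to_column :: "'m \<Rightarrow> real ^ 'p \<Rightarrow> real ^ 'm ^ 'p \<Rightarrow> real ^ 'm ^ 'p" where
  "add_to_column i u Y = (\<chi> r c. if c = i then Y $ r $ c + u $ r else Y $ r $ c)"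

text \<open>
  The iterations for given sequences of row indices \<open>is\<close> and column indices \<open>js\<close>: step \<open>k\<close>, which
  leads from iterate \<open>k\<close> to iterate \<open>k + 1\<close>, uses \<open>is k\<close> and \<open>js k\<close>.
\<close>

definition row_coeff :: "real ^ 'n ^ 'm \<Rightarrow> 'm \<Rightarrow> real ^ 'n ^ 'p \<Rightarrow> real ^ 'p" where
  "row_coeff A i R = (1 / (norm (row i A))\<^sup>2) *\<^sub>R (R *v row i A)"

primrec R_iter ::
  "real ^ 'n ^ 'm \<Rightarrow> real ^ 'n ^ 'p \<Rightarrow> real ^ 'm ^ 'p \<Rightarrow> (nat \<Rightarrow> 'm) \<Rightarrow> nat \<Rightarrow> real ^ 'n ^ 'p" where
  "R_iter A C Y0 is 0 = C - Y0 ** A"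
| "R_iter A C Y0 is (Suc k) =
     R_iter A C Y0 is k
       - outer (row_coeff A (is k) (R_iter A C Y0 is k)) (row (is k) A)"

primrec Y_iter ::
  "real ^ 'n ^ 'm \<Rightarrow> real ^ 'n ^ 'p \<Rightarrow> real ^ 'm ^ 'p \<Rightarrow> (nat \<Rightarrow> 'm) \<Rightarrow> nat \<Rightarrow> real ^ 'm ^ 'p" where
  "Y_iter A C Y0 is 0 = Y0"
| "Y_iter A C Y0 is (Suc k) =
     add_to_column (is k) (row_coeff A (is k) (R_iter A C Y0 is k)) (Y_iter A C Y0 is k)"

primrec X_iter ::
  "real ^ 'n ^ 'm \<Rightarrow> real ^ 'n ^ 'p \<Rightarrow> real ^ 'm ^ 'p \<Rightarrow> real ^ 'm ^ 'p \<Rightarrow>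
     (nat \<Rightarrow> 'm) \<Rightarrow> (nat \<Rightarrow> 'n) \<Rightarrow> nat \<Rightarrow> real ^ 'm ^ 'p" where
  "X_iter A C X0 Y0 is js 0 = X0"
| "X_iter A C X0 Y0 is js (Suc k) =
     X_iter A C X0 Y0 is js k
       - outer ((1 / (norm (column (js k) A))\<^sup>2) *\<^sub>R
                 ((X_iter A C X0 Y0 is js k - Y_iter A C Y0 is (Suc k)) *v column (js k) A))
               (column (js k) A)"

text \<open>
  Integrability is demanded explicitly because the library's integral of a non-integrable
  function is 0.
\<close>

definition converges_linearly_in_mean_square ::
  "'w measure \<Rightarrow> (nat \<Rightarrow> 'w \<Rightarrow> 'a::real_normed_vector) \<Rightarrow> 'a \<Rightarrow> bool" where
  "converges_linearly_in_mean_square M X L \<longleftrightarrow>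
     (\<forall>k. integrable M (\<lambda>\<omega>. (norm (X k \<omega> - L))\<^sup>2)) \<and>
     (\<exists>c\<ge>0. \<exists>q. 0 \<le> q \<and> q < 1 \<and>
        (\<forall>k. (\<integral>\<omega>. (norm (X k \<omega> - L))\<^sup>2 \<partial>M) \<le> c * q ^ k))"

text \<open>
  The row and column indices have different types, so the family of all of them is indexed by
  \<open>nat + nat\<close> and takes values in \<open>'m + 'n\<close>. Its mutual independence covers different iterations
  as well as row versus column indices.
\<close>

definition random_index_selection ::
  "'w measure \<Rightarrow> real ^ 'n ^ 'm \<Rightarrow> (nat \<Rightarrow> 'w \<Rightarrow> 'm) \<Rightarrow> (nat \<Rightarrow> 'w \<Rightarrow> 'n) \<Rightarrow> bool" where
  "random_index_selection M A I J \<longleftrightarrow>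
     prob_space.indep_vars M (\<lambda>_. count_space UNIV)
       (case_sum (\<lambda>k \<omega>. Inl (I k \<omega>)) (\<lambda>k \<omega>. Inr (J k \<omega>))) (UNIV :: (nat + nat) set) \<and>
     (\<forall>k i. measure M {\<omega> \<in> space M. I k \<omega> = i} = (norm (row i A))\<^sup>2 / (norm A)\<^sup>2) \<and>
     (\<forall>k j. measure M {\<omega> \<in> space M. J k \<omega> = j} = (norm (column j A))\<^sup>2 / (norm A)\<^sup>2)"

end

theory Submission
  imports Defs
begin

text \<open>
  Let \<open>X\<^sup>* = C A\<^sup>+\<close>. Since \<open>(C - X\<^sup>* A) A\<^sup>T = 0\<close>, a row update projects every row of
  \<open>(Y - X\<^sup>*) A\<close> onto the orthogonal complement of the selected row of \<open>A\<close>. A column update does the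
  same to \<open>X - X\<^sup>*\<close> with the selected column \<open>a\<close> and adds the orthogonal perturbation
  \<open>(Y - X\<^sup>*) a a\<^sup>T / |a|\<^sup>2\<close>. Averaging the two Pythagorean identities over the selection turns the
  removed parts into \<open>|(Y - X\<^sup>*) A A\<^sup>T|\<^sup>2 / |A|\<^sup>2\<close> and \<open>|(X - X\<^sup>*) A|\<^sup>2 / |A|\<^sup>2\<close>, and all rows stay in the row
  or column space of \<open>A\<close>, where \<open>\<sigma>\<^sub>m\<^sub>i\<^sub>n\<close> bounds \<open>A\<close> and \<open>A\<^sup>T\<close> from below. So the expected squared
  errors satisfy \<open>y\<^sub>k\<^sub>+\<^sub>1 \<le> \<rho> y\<^sub>k\<close> and \<open>x\<^sub>k\<^sub>+\<^sub>1 \<le> \<rho> x\<^sub>k + y\<^sub>k\<^sub>+\<^sub>1 / |A|\<^sup>2\<close>.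
\<close>

section \<open>The Moore--Penrose inverse\<close>

lemma inner_matrix_vector_transpose:
  fixes A :: "real ^ 'n ^ 'm"
  shows "inner (A *v x) y = inner x (transpose A *v y)"
  by (metis dot_lmul_matrix inner_commute transpose_matrix_vector)

text \<open>In this form the symmetry of a sum or difference of matrices follows from bilinearity of
  the inner product.\<close>

lemma transpose_eq_self_iff:
  fixes B :: "real ^ 'n ^ 'n"
  shows "transpose B = B \<longleftrightarrow> (\<forall>x y. inner (B *v x) y = inner x (B *v y))"
proof
  assume B: "\<forall>x y. inner (B *v x) y = inner x (B *v y)"
  have "transpose B *v x = B *v x" for x
  proof (rule vector_eq_ldot[THEN iffD1], intro allI)
    fix y
    show "inner y (transpose B *v x) = inner y (B *v x)"
      by (metis B inner_commute inner_matrix_vector_transpose)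
  qed
  then show "transpose B = B"
    by (simp add: matrix_eq)
qed (metis inner_matrix_vector_transpose)

text \<open>The projection is the sum of \<open>b b^T\<close> over an orthonormal basis of
  \<open>S\<close>. Each summand is self-adjoint, and orthonormality makes the sum fix the basis,
  hence its span.\<close>

lemma orthogonal_projection_matrix_exists:
  fixes S :: "(real ^ 'n) set"
  assumes S: "subspace S"
  obtains P :: "real ^ 'n ^ 'n"
  where "transpose P = P" "\<And>x. P *v x \<in> S" "\<And>x. x \<in> S \<Longrightarrow> P *v x = x"
proof -
  obtain B where BS: "B \<subseteq> S" and B: "pairwise orthogonal B" "\<And>x. x \<in> B \<Longrightarrow> norm x = 1"
    and "independent B" and span: "span B = S"
    using orthonormal_basis_subspace[OF S] by metis
  then have fin: "finite B"
    using independent_bound by blast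
  define f where "f x = (\<Sum>b\<in>B. inner b x *\<^sub>R b)" for x
  have lin: "linear f"
    unfolding f_def
    by (intro linear_compose_sum ballI linearI) (simp_all add: inner_add_right scaleR_add_left)
  have P: "matrix f *v x = f x" for x
    using lin by (simp add: matrix_works)
  have sym: "inner (f x) y = inner x (f y)" for x y
    unfolding f_def by (simp add: inner_sum_left inner_sum_right inner_commute mult.commute)
  have in_S: "f x \<in> S" for x
    unfolding f_def using BS S by (intro subspace_sum subspace_scale) auto
  have fb: "f b = b" if "b \<in> B" for b
  proof -
    have "f b = (\<Sum>a\<in>B. if a = b then b else 0)"
      unfolding f_def using B that
      by (intro sum.cong) (auto simp: pairwise_def orthogonal_def norm_eq_1)
    then show ?thesis
      using fin that by simp
  qed
  have fid: "f x = x" if "x \<in> S" for x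
    using linear_eq_on_span[OF lin linear_id, of B x] fb that span by simp
  show ?thesis
    using that[of "matrix f"] by (simp add: transpose_eq_self_iff P sym in_S fid)
qed

text \<open>Pairing the left-hand vector with \<open>x\<close> gives the squared norm of
  \<open>A *v x\<close>.\<close>

lemma gram_zero_iff:
  fixes A :: "real ^ 'n ^ 'm"
  shows "transpose A *v (A *v x) = 0 \<longleftrightarrow> A *v x = 0"
  by (metis inner_eq_zero_iff inner_matrix_vector_transpose inner_zero_right
      matrix_vector_mult_0_right)

text \<open>
  With \<open>P\<close> the orthogonal projection onto the kernel of \<open>A\<close>, the matrix \<open>A\<^sup>T A + P\<close> is
  invertible, and \<open>(A\<^sup>T A + P)\<^sup>-\<^sup>1 A\<^sup>T\<close> satisfies the Penrose conditions.
\<close>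

lemma moore_penrose_exists:
  fixes A :: "real ^ 'n ^ 'm"
  shows "\<exists>B. is_moore_penrose A B"
proof -
  have "subspace {x. A *v x = 0}"
    by (simp add: subspace_def matrix_vector_right_distrib matrix_vector_mult_scaleR)
  then obtain P :: "real ^ 'n ^ 'n" where
    Psym: "transpose P = P" and AP: "\<And>x. A *v (P *v x) = 0"
    and Pid: "\<And>x. A *v x = 0 \<Longrightarrow> P *v x = x"
    by (rule orthogonal_projection_matrix_exists) auto
  have AP0: "A ** P = 0"
    by (simp add: matrix_eq matrix_vector_mul_assoc[symmetric] AP)
  have PA0: "P ** transpose A = 0"
    using arg_cong[OF AP0, of transpose] Psym
    by (simp add: matrix_transpose_mul vec_eq_iff[of "transpose 0"] vec_eq_iff transpose_def[of 0])
  have PP: "P ** P = P"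
    by (simp add: matrix_eq matrix_vector_mul_assoc[symmetric] Pid AP)
  define G where "G = transpose A ** A + P"
  have Gsym: "transpose G = G"
  proof -
    have "transpose (transpose A ** A) = transpose A ** A"
      by (simp add: matrix_transpose_mul)
    with Psym show ?thesis
      unfolding G_def transpose_eq_self_iff
      by (simp only: matrix_vector_mult_add_rdistrib inner_add_left inner_add_right) simp
  qed
  have "inj ((*v) G)"
  proof (rule injI)
    fix x y
    assume "G *v x = G *v y"
    then have G0: "G *v (x - y) = 0"
      by (simp add: matrix_vector_mult_diff_distrib)
    define v where "v = x - y"
    \<comment> \<open>Multiplying by \<open>P\<close> kills the Gram part, so
      \<open>G *v v = 0\<close> splits into \<open>P *v v = 0\<close> and a Gram equation. The
      latter puts \<open>v\<close> in the kernel of \<open>A\<close>, where \<open>P\<close> is the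
      identity.\<close>
    have "P *v (G *v v) = P *v v"
      by (simp add: G_def matrix_vector_mul_assoc matrix_add_ldistrib matrix_mul_assoc PA0 PP)
    then have P0: "P *v v = 0"
      using G0 by (simp add: v_def)
    then have "transpose A *v (A *v v) = 0"
      using G0 by (simp add: G_def v_def matrix_vector_mult_add_rdistrib matrix_vector_mul_assoc)
    then have "P *v v = v"
      using Pid gram_zero_iff by blast
    then show "x = y"
      using P0 by (simp add: v_def)
  qed
  then obtain H where HG: "H ** G = mat 1"
    using matrix_left_invertible_injective by blast
  then have GH: "G ** H = mat 1"
    using matrix_left_right_inverse by blast
  have Hsym: "transpose H = H"
    using HG GH Gsym by (metis matrix_mul_assoc matrix_mul_lid matrix_mul_rid matrix_transpose_mul transpose_mat)
  \<comment> \<open>\<open>G\<close> is the identity on the kernel of \<open>A\<close>, hence so is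
    its inverse. This makes \<open>B ** A\<close> below the projection onto the orthogonal
    complement of the kernel.\<close>
  have "G ** P = P"
    by (simp add: G_def matrix_eq matrix_vector_mult_add_rdistrib AP Pid flip: matrix_vector_mul_assoc)
  then have HP: "H ** P = P"
    by (metis HG matrix_mul_assoc matrix_mul_lid)
  define B where "B = H ** transpose A"
  have BA: "B ** A = mat 1 - P"
  proof -
    have "H ** (transpose A ** A) + H ** P = mat 1"
      using HG by (simp add: G_def matrix_add_ldistrib)
    then show ?thesis
      by (simp add: B_def HP matrix_mul_assoc algebra_simps)
  qed
  have PB: "P ** B = 0"
  proof -
    have "P ** H = P"
      using arg_cong[OF HP, of transpose] by (simp add: matrix_transpose_mul Hsym Psym)
    then show ?thesis
      by (simp add: B_def matrix_mul_assoc PA0)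
  qed
  have "A ** B ** A = A"
    by (simp add: matrix_mul_assoc[symmetric] BA matrix_eq matrix_vector_mult_diff_distrib
        matrix_vector_mult_diff_rdistrib AP flip: matrix_vector_mul_assoc)
  moreover have "B ** A ** B = B"
    by (simp add: BA matrix_eq matrix_vector_mul_assoc matrix_vector_mult_diff_rdistrib PB
        flip: matrix_vector_mul_assoc) (simp add: matrix_vector_mul_assoc PB)
  moreover have "transpose (A ** B) = A ** B"
    by (simp add: B_def matrix_transpose_mul Hsym matrix_mul_assoc)
  moreover have "transpose (B ** A) = B ** A"
    unfolding BA using Psym
    by (simp add: transpose_eq_self_iff matrix_vector_mult_diff_rdistrib inner_diff_left inner_diff_right)
  ultimately show ?thesis
    unfolding is_moore_penrose_def by blast
qed

text \<open>Each of the symmetric products \<open>A ** B\<close> and \<open>A ** C\<close> absorbs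
  the other, and transposition swaps the factors, so they agree; likewise \<open>B ** A\<close> and
  \<open>C ** A\<close>. These two equalities turn \<open>B ** A ** B\<close> into
  \<open>C ** A ** C\<close>.\<close>

lemma moore_penrose_unique:
  assumes B: "is_moore_penrose A B" and C: "is_moore_penrose A C"
  shows "B = C"
proof -
  have "A ** B = (A ** C) ** (A ** B)"
    using C by (simp add: is_moore_penrose_def matrix_mul_assoc)
  also have "\<dots> = transpose ((A ** B) ** (A ** C))"
    using B C by (simp add: is_moore_penrose_def matrix_transpose_mul[of "A ** B" "A ** C"])
  also have "(A ** B) ** (A ** C) = A ** C"
    using B by (simp add: is_moore_penrose_def matrix_mul_assoc)
  finally have AB: "A ** B = A ** C"
    using C by (simp add: is_moore_penrose_def)
  have "B ** A = (B ** A) ** (C ** A)"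
    using C by (simp add: is_moore_penrose_def flip: matrix_mul_assoc)
  also have "\<dots> = transpose ((C ** A) ** (B ** A))"
    using B C by (simp add: is_moore_penrose_def matrix_transpose_mul[of "C ** A" "B ** A"])
  also have "(C ** A) ** (B ** A) = C ** A"
    using B by (simp add: is_moore_penrose_def flip: matrix_mul_assoc)
  finally have BA: "B ** A = C ** A"
    using C by (simp add: is_moore_penrose_def)
  have "B = B ** A ** B"
    using B by (simp add: is_moore_penrose_def)
  also have "\<dots> = C ** A ** C"
    by (metis AB BA matrix_mul_assoc)
  finally show ?thesis
    using C by (simp add: is_moore_penrose_def)
qed

lemma is_moore_penrose_moore_penrose: "is_moore_penrose A (moore_penrose A)"
  unfolding moore_penrose_def
  by (rule theI2[of "is_moore_penrose A", OF someI_ex[OF moore_penrose_exists]])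
    (auto intro: moore_penrose_unique someI_ex[OF moore_penrose_exists])

section \<open>The smallest nonzero singular value\<close>

text \<open>Needed for \<open>Min\<close> in \<open>sigma_min\<close> to be attained. Eigenvectors
  of a symmetric matrix for distinct eigenvalues are orthogonal, and orthogonal nonzero vectors are
  independent, hence finitely many. Nonnegativity keeps the squares of distinct singular values
  distinct.\<close>

lemma finite_singular_values:
  fixes A :: "real ^ 'n ^ 'm"
  shows "finite (singular_values A)"
proof -
  define S where "S = transpose A ** A"
  have "\<forall>s\<in>singular_values A. \<exists>v. v \<noteq> 0 \<and> S *v v = s\<^sup>2 *\<^sub>R v"
    by (simp add: singular_values_def S_def)
  then obtain v where v: "\<And>s. s \<in> singular_values A \<Longrightarrow> v s \<noteq> 0 \<and> S *v v s = s\<^sup>2 *\<^sub>R v s"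
    by metis
  have sym: "inner (S *v x) y = inner x (S *v y)" for x y
    using transpose_eq_self_iff[of S] by (simp add: S_def matrix_transpose_mul)
  have orth: "orthogonal (v s) (v t)"
    if s: "s \<in> singular_values A" and t: "t \<in> singular_values A" and "s \<noteq> t" for s t
  proof -
    have "s\<^sup>2 * inner (v s) (v t) = inner (S *v v s) (v t)"
      using v[OF s] by simp
    also have "\<dots> = inner (v s) (S *v v t)"
      using sym by blast
    also have "\<dots> = t\<^sup>2 * inner (v s) (v t)"
      using v[OF t] by simp
    finally have "inner (v s) (v t) = 0 \<or> s\<^sup>2 = t\<^sup>2"
      by simp
    moreover have "s\<^sup>2 \<noteq> t\<^sup>2"
      using s t \<open>s \<noteq> t\<close> by (auto simp: singular_values_def power2_eq_iff)
    ultimately show ?thesis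
      by (simp add: orthogonal_def)
  qed
  have inj: "inj_on v (singular_values A)"
    using orth v by (metis inj_onI orthogonal_self)
  have "pairwise orthogonal (v ` singular_values A)"
    using orth by (force simp: pairwise_def)
  moreover have "0 \<notin> v ` singular_values A"
    using v by (metis imageE)
  ultimately have "finite (v ` singular_values A)"
    using pairwise_orthogonal_independent independent_imp_finite by blast
  then show ?thesis
    using inj finite_image_iff by blast
qed

text \<open>
  A minimiser of \<open>|A v|\<close> on the unit sphere of the row space is an eigenvector of \<open>A\<^sup>T A\<close>, because
  the gradient of \<open>|A v|\<^sup>2 - \<lambda> |v|\<^sup>2\<close> along the row space vanishes there and \<open>A\<^sup>T A\<close> preserves
  the row space.
\<close>

lemma least_singular_value_on_row_space:
  fixes A :: "real ^ 'n ^ 'm"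
  assumes "A \<noteq> 0"
  obtains s where "s \<in> singular_values A" "0 < s"
    "\<And>x. x \<in> range ((*v) (transpose A)) \<Longrightarrow> s * norm x \<le> norm (A *v x)"
proof -
  define V where "V = range ((*v) (transpose A))"
  have V: "subspace V"
    unfolding V_def by (intro linear_subspace_image subspace_UNIV) simp
  have V_eq0: "x = 0" if "x \<in> V" "A *v x = 0" for x
  proof -
    obtain y where "x = transpose A *v y"
      using \<open>x \<in> V\<close> by (auto simp: V_def)
    then show ?thesis
      using \<open>A *v x = 0\<close> gram_zero_iff[of "transpose A" y] by simp
  qed
  have "transpose A \<noteq> 0"
    using assms by (metis transpose_transpose matrix_vector_mult_0 matrix_eq
        inner_matrix_vector_transpose inner_zero_right inner_eq_zero_iff)
  then obtain y where y: "transpose A *v y \<noteq> 0"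
    using matrix_eq by (metis matrix_vector_mult_0)
  define w where "w = transpose A *v y"
  have w: "w \<in> V" "w \<noteq> 0"
    using y by (auto simp: w_def V_def)
  have "compact (V \<inter> sphere 0 1)"
    by (simp add: V closed_subspace closed_Int_compact)
  moreover have "w /\<^sub>R norm w \<in> V \<inter> sphere 0 1"
    using w V by (simp add: subspace_scale)
  then have "V \<inter> sphere 0 1 \<noteq> {}"
    by blast
  moreover have "continuous_on (V \<inter> sphere 0 1) (\<lambda>x. norm (A *v x))"
    by (intro continuous_intros linear_continuous_on) simp
  ultimately obtain v where "v \<in> V \<inter> sphere 0 1"
    and "\<forall>x\<in>V \<inter> sphere 0 1. norm (A *v v) \<le> norm (A *v x)"
    using continuous_attains_inf[of "V \<inter> sphere 0 1" "\<lambda>x. norm (A *v x)"] by metis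
  then have v: "v \<in> V" "norm v = 1"
    and min: "\<And>x. x \<in> V \<Longrightarrow> norm x = 1 \<Longrightarrow> norm (A *v v) \<le> norm (A *v x)"
    by auto
  define s where "s = norm (A *v v)"
  have bound: "s * norm x \<le> norm (A *v x)" if "x \<in> V" for x
  proof (cases "x = 0")
    case False
    then have "s \<le> norm (A *v (x /\<^sub>R norm x))"
      unfolding s_def using that V by (intro min subspace_scale) auto
    then show ?thesis
      using False by (simp add: matrix_vector_mult_scaleR field_simps)
  qed simp
  \<comment> \<open>Half the gradient at \<open>v\<close> of the form \<open>Q\<close> below. It
    lies in \<open>V\<close>, so moving from \<open>v\<close> along \<open>d\<close> stays where
    \<open>Q\<close> is nonnegative, starting from \<open>Q v = 0\<close>.\<close>
  define d where "d = transpose A *v (A *v v) - s\<^sup>2 *\<^sub>R v"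
  have "d \<in> V"
    unfolding d_def by (intro subspace_diff subspace_scale V v) (simp add: V_def)
  define Q where "Q x = (norm (A *v x))\<^sup>2 - s\<^sup>2 * (norm x)\<^sup>2" for x
  have expand: "Q (v + t *\<^sub>R d) = 2 * t * (norm d)\<^sup>2 + t\<^sup>2 * Q d" for t
  proof -
    have "inner (A *v v) (A *v d) = inner d d + s\<^sup>2 * inner v d"
    proof -
      have "inner d d = inner d (transpose A *v (A *v v)) - s\<^sup>2 * inner d v"
        by (subst (2) d_def) (simp only: inner_diff_right inner_scaleR_right)
      then show ?thesis
        using inner_matrix_vector_transpose[of A d "A *v v"] by (simp only: inner_commute)
    qed
    moreover have "inner (A *v v) (A *v v) = s\<^sup>2" "inner v v = 1"
      using v by (simp_all add: s_def flip: power2_norm_eq_inner)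
    moreover have "A *v (v + t *\<^sub>R d) = A *v v + t *\<^sub>R (A *v d)"
      by (simp add: matrix_vector_right_distrib matrix_vector_mult_scaleR)
    ultimately show ?thesis
      unfolding Q_def power2_norm_eq_inner
      by (simp add: inner_add_left inner_add_right inner_commute algebra_simps power2_eq_square)
  qed
  have Q_nonneg: "0 \<le> Q (v + t *\<^sub>R d)" for t
  proof -
    have "(s * norm (v + t *\<^sub>R d))\<^sup>2 \<le> (norm (A *v (v + t *\<^sub>R d)))\<^sup>2"
      using V v \<open>d \<in> V\<close>
      by (intro power_mono bound subspace_add subspace_scale) (simp_all add: s_def)
    then show ?thesis
      by (simp add: Q_def power_mult_distrib)
  qed
  have "norm d = 0"
  proof (rule ccontr)
    assume "norm d \<noteq> 0"
    define n where "n = (norm d)\<^sup>2"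
    have n: "0 < n" using \<open>norm d \<noteq> 0\<close> by (simp add: n_def)
    \<comment> \<open>A step against the gradient, so short that the quadratic term cannot outweigh
      the linear one; the \<open>+ 1\<close> keeps the denominator positive.\<close>
    define t where "t = - n / (\<bar>Q d\<bar> + 1)"
    have t: "t < 0" using n by (simp add: t_def divide_neg_pos)
    have "- t * \<bar>Q d\<bar> \<le> n"
      using n by (simp add: t_def field_simps)
    then have "- t * Q d \<le> n"
      using t by (smt (verit) mult_left_mono)
    then have "2 * n + t * Q d > 0"
      using n by simp
    then have "t * (2 * n + t * Q d) < 0"
      using t by (simp add: mult_neg_pos)
    then show False
      using Q_nonneg[of t] expand[of t] by (simp add: n_def algebra_simps power2_eq_square)
  qed
  then have "(transpose A ** A) *v v = s\<^sup>2 *\<^sub>R v"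
    by (simp add: d_def flip: matrix_vector_mul_assoc)
  moreover have "v \<noteq> 0"
    using v by auto
  moreover have "0 < s"
    using V_eq0 v \<open>v \<noteq> 0\<close> by (auto simp: s_def)
  ultimately have "s \<in> singular_values A"
    by (auto simp: singular_values_def)
  then show ?thesis
    using that \<open>0 < s\<close> bound by (simp add: V_def)
qed

text \<open>The preceding lemma supplies a positive singular value, so the minimum is over a
  nonempty set. It is at most that value and inherits its lower bound.\<close>

lemma
  fixes A :: "real ^ 'n ^ 'm"
  assumes "A \<noteq> 0"
  shows sigma_min_in: "sigma_min A \<in> singular_values A"
    and sigma_min_pos: "0 < sigma_min A"
    and sigma_min_le_on_row_space:
      "x \<in> range ((*v) (transpose A)) \<Longrightarrow> sigma_min A * norm x \<le> norm (A *v x)"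
proof -
  obtain s where s: "s \<in> singular_values A" "0 < s"
    and bound: "\<And>x. x \<in> range ((*v) (transpose A)) \<Longrightarrow> s * norm x \<le> norm (A *v x)"
    using least_singular_value_on_row_space[OF assms] by blast
  have fin: "finite (singular_values A - {0})"
    by (simp add: finite_singular_values)
  have "sigma_min A \<in> singular_values A - {0}"
    unfolding sigma_min_def using fin s by (intro Min_in) auto
  then show "sigma_min A \<in> singular_values A" "0 < sigma_min A"
    by (auto simp: singular_values_def)
  have "sigma_min A \<le> s"
    unfolding sigma_min_def using fin s by (intro Min_le) auto
  then show "sigma_min A * norm x \<le> norm (A *v x)" if "x \<in> range ((*v) (transpose A))"
    using bound[OF that] by (meson mult_right_mono norm_ge_zero order_trans)
qed

text \<open>Avoids comparing the singular values of \<open>A\<close> and \<open>transpose A\<close>: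
  a preimage \<open>v\<close> of \<open>x\<close> in the row space satisfies
  \<open>sigma_min A * norm v \<le> norm x\<close>, and Cauchy-Schwarz applies to the inner product
  of \<open>v\<close> and \<open>transpose A *v x\<close>, which is the squared norm of
  \<open>x\<close>.\<close>

lemma sigma_min_le_on_column_space:
  fixes A :: "real ^ 'n ^ 'm"
  assumes "A \<noteq> 0" and x: "x \<in> range ((*v) A)"
  shows "sigma_min A * norm x \<le> norm (transpose A *v x)"
proof (cases "x = 0")
  case False
  obtain y where y: "x = A *v y"
    using x by blast
  have mp: "A ** moore_penrose A ** A = A"
    "transpose (moore_penrose A ** A) = moore_penrose A ** A"
    using is_moore_penrose_moore_penrose[of A] by (auto simp: is_moore_penrose_def)
  \<comment> \<open>The row-space component of \<open>y\<close>, which has the same image under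
    \<open>A\<close>.\<close>
  define v where "v = (moore_penrose A ** A) *v y"
  have xv: "x = A *v v"
    by (simp add: v_def y matrix_vector_mul_assoc matrix_mul_assoc mp)
  have "v = transpose A *v (transpose (moore_penrose A) *v y)"
    unfolding v_def by (metis matrix_transpose_mul matrix_vector_mul_assoc mp(2))
  then have le: "sigma_min A * norm v \<le> norm x"
    unfolding xv by (intro sigma_min_le_on_row_space assms) blast
  have "(norm x)\<^sup>2 = inner v (transpose A *v x)"
    unfolding power2_norm_eq_inner using inner_matrix_vector_transpose[of A v x] xv by simp
  also have "\<dots> \<le> norm v * norm (transpose A *v x)"
    by (rule norm_cauchy_schwarz)
  finally have "sigma_min A * (norm x)\<^sup>2 \<le> sigma_min A * norm v * norm (transpose A *v x)"
    using sigma_min_pos[OF \<open>A \<noteq> 0\<close>] by (simp add: mult.assoc)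
  also have "\<dots> \<le> norm x * norm (transpose A *v x)"
    using le by (rule mult_right_mono) simp
  finally show ?thesis
    using False by (simp add: power2_eq_square)
qed simp

section \<open>The Frobenius norm by rows and columns\<close>

lemma norm_matrix_power2: "(norm (A :: real ^ 'n ^ 'm))\<^sup>2 = (\<Sum>i\<in>UNIV. (norm (row i A))\<^sup>2)"
  by (simp add: norm_vec_def L2_set_def sum_nonneg row_def)

lemma norm_transpose: "norm (transpose (A :: real ^ 'n ^ 'm)) = norm A"
proof -
  have "(norm (transpose A))\<^sup>2 = (norm A)\<^sup>2"
    unfolding norm_matrix_power2 norm_vec_def L2_set_def
    by (simp add: sum_nonneg row_def column_def transpose_def) (rule sum.swap)
  then show ?thesis
    by simp
qed

lemma norm_matrix_power2_columns:
  "(norm (A :: real ^ 'n ^ 'm))\<^sup>2 = (\<Sum>j\<in>UNIV. (norm (column j A))\<^sup>2)"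
  using norm_matrix_power2[of "transpose A"] by (simp add: norm_transpose)

lemma norm_matrix_vector_le:
  fixes A :: "real ^ 'n ^ 'm"
  shows "norm (A *v x) \<le> norm A * norm x"
proof -
  have "(norm (A *v x))\<^sup>2 = (\<Sum>i\<in>UNIV. (inner (row i A) x)\<^sup>2)"
    by (simp add: norm_vec_def[of "A *v x"] L2_set_def sum_nonneg matrix_vector_mul_component row_def)
  also have "\<dots> \<le> (\<Sum>i\<in>UNIV. (norm (row i A) * norm x)\<^sup>2)"
    by (intro sum_mono) (simp add: power2_le_iff_abs_le Cauchy_Schwarz_ineq2)
  also have "\<dots> = (norm A * norm x)\<^sup>2"
    by (simp add: norm_matrix_power2 power_mult_distrib sum_distrib_right)
  finally show ?thesis
    by (simp add: power2_le_iff_abs_le)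
qed

text \<open>Makes the contraction factor nonnegative. An eigenvector for \<open>sigma_min A\<close>
  is stretched by exactly that factor, and the Frobenius norm dominates the operator norm.\<close>

lemma sigma_min_le_norm:
  fixes A :: "real ^ 'n ^ 'm"
  assumes "A \<noteq> 0"
  shows "sigma_min A \<le> norm A"
proof -
  obtain v where v: "v \<noteq> 0" "(transpose A ** A) *v v = (sigma_min A)\<^sup>2 *\<^sub>R v"
    using sigma_min_in[OF assms] by (auto simp: singular_values_def)
  have "(sigma_min A * norm v)\<^sup>2 = inner v ((transpose A ** A) *v v)"
    unfolding v by (simp add: power_mult_distrib power2_norm_eq_inner)
  also have "\<dots> = (norm (A *v v))\<^sup>2"
    by (simp add: inner_matrix_vector_transpose power2_norm_eq_inner flip: matrix_vector_mul_assoc)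
  also have "\<dots> \<le> (norm A * norm v)\<^sup>2"
    by (intro power_mono norm_matrix_vector_le) simp
  finally have "sigma_min A * norm v \<le> norm A * norm v"
    by (rule power2_le_imp_le) simp
  then show ?thesis
    using v by simp
qed

section \<open>One projection step\<close>

text \<open>One formula for both iterations: the column update of the error \<open>E\<close> of
  \<open>X\<close> with \<open>Z\<close> the error of \<open>Y\<close>, and, for
  \<open>transpose A\<close> and \<open>Z = 0\<close>, the row update of the error of
  \<open>Y ** A\<close>.\<close>

definition column_step :: "real ^ 'n ^ 'm \<Rightarrow> real ^ 'm ^ 'p \<Rightarrow> real ^ 'm ^ 'p \<Rightarrow> 'n \<Rightarrow> real ^ 'm ^ 'p" where
  "column_step A Z E j =
     E - outer ((1 / (norm (column j A))\<^sup>2) *\<^sub>R ((E - Z) *v column j A)) (column j A)"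

text \<open>
  The rows of \<open>E\<close> and \<open>Z\<close> only contribute their components orthogonal and parallel to \<open>a\<close>,
  respectively.
\<close>

lemma norm_projection_step:
  fixes E Z :: "real ^ 'm ^ 'p"
  assumes "a \<noteq> 0"
  shows "(norm (E - outer ((1 / (norm a)\<^sup>2) *\<^sub>R ((E - Z) *v a)) a))\<^sup>2 =
    (norm E)\<^sup>2 - (norm (E *v a))\<^sup>2 / (norm a)\<^sup>2 + (norm (Z *v a))\<^sup>2 / (norm a)\<^sup>2"
proof -
  have vec: "(norm (e - (inner (e - z) a / (norm a)\<^sup>2) *\<^sub>R a))\<^sup>2 =
      (norm e)\<^sup>2 - (inner e a)\<^sup>2 / (norm a)\<^sup>2 + (inner z a)\<^sup>2 / (norm a)\<^sup>2" for e z
  proof -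
    \<comment> \<open>With this \<open>c\<close>, the linear and quadratic terms in \<open>c\<close>
      combine to a difference of squares, so no mixed term of \<open>e\<close> and \<open>z\<close>
      survives.\<close>
    define c where "c = inner (e - z) a / (norm a)\<^sup>2"
    have c: "c * (norm a)\<^sup>2 = inner e a - inner z a"
      using assms by (simp add: c_def inner_diff_left)
    have "(norm (e - c *\<^sub>R a))\<^sup>2 = (norm e)\<^sup>2 - 2 * c * inner e a + c * (c * (norm a)\<^sup>2)"
      unfolding power2_norm_eq_inner
      by (simp add: inner_diff_left inner_diff_right inner_commute[of a e] algebra_simps)
    also have "\<dots> = (norm e)\<^sup>2 - c * (inner e a + inner z a)"
      unfolding c by (simp add: algebra_simps)
    also have "\<dots> = (norm e)\<^sup>2 - (inner e a - inner z a) * (inner e a + inner z a) / (norm a)\<^sup>2"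
      by (simp add: c_def inner_diff_left)
    also have "\<dots> = (norm e)\<^sup>2 - (inner e a)\<^sup>2 / (norm a)\<^sup>2 + (inner z a)\<^sup>2 / (norm a)\<^sup>2"
      by (simp add: power2_eq_square diff_divide_distrib algebra_simps)
    finally show ?thesis
      unfolding c_def .
  qed
  have row: "row r (E - outer ((1 / (norm a)\<^sup>2) *\<^sub>R ((E - Z) *v a)) a) =
      row r E - (inner (row r E - row r Z) a / (norm a)\<^sup>2) *\<^sub>R a" for r
    by (simp add: vec_eq_iff row_def outer_def matrix_vector_mul_component)
  have prod: "(norm (B *v a))\<^sup>2 = (\<Sum>r\<in>UNIV. (inner (row r B) a)\<^sup>2)" for B :: "real ^ 'm ^ 'p"
    by (simp add: norm_vec_def[of "B *v a"] L2_set_def sum_nonneg matrix_vector_mul_component row_def)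
  show ?thesis
    by (simp add: norm_matrix_power2 row vec prod sum.distrib sum_subtractf sum_divide_distrib)
qed

lemma column_matrix_mult: "column j (B ** A) = B *v column j A"
  by (simp add: vec_eq_iff column_def matrix_matrix_mult_def matrix_vector_mult_def)

lemma row_matrix_mult: "row r (B ** A) = transpose A *v row r B" for A :: "real ^ 'n ^ 'm"
  by (auto simp: vec_eq_iff row_def matrix_matrix_mult_def matrix_vector_mult_def transpose_def
      simp del: transpose_matrix_vector intro!: sum.cong mult.commute)

lemma sum_column_weights:
  fixes A :: "real ^ 'n ^ 'm"
  assumes "A \<noteq> 0"
  shows "(\<Sum>j\<in>UNIV. (norm (column j A))\<^sup>2 / (norm A)\<^sup>2) = 1"
  using assms by (simp add: norm_matrix_power2_columns[symmetric] flip: sum_divide_distrib)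

text \<open>The probabilities cancel the denominators of the projection step, so the projected parts
  add up to the squared norms of \<open>E ** A\<close> and \<open>Z ** A\<close>;
  \<open>lower\<close> is then squared and summed over the rows. The constant \<open>s\<close> is
  left free so that \<open>sigma_min A\<close> can also serve for
  \<open>transpose A\<close>.\<close>

lemma mean_column_step_le:
  fixes A :: "real ^ 'n ^ 'm" and E Z :: "real ^ 'm ^ 'p"
  assumes nz: "\<And>j. column j A \<noteq> 0"
    and lower: "\<And>r. s * norm (row r E) \<le> norm (transpose A *v row r E)" and "0 \<le> s"
  shows "(\<Sum>j\<in>UNIV. (norm (column j A))\<^sup>2 / (norm A)\<^sup>2 * (norm (column_step A Z E j))\<^sup>2) \<le>
    (1 - s\<^sup>2 / (norm A)\<^sup>2) * (norm E)\<^sup>2 + (norm (Z ** A))\<^sup>2 / (norm A)\<^sup>2"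
proof -
  have "A \<noteq> 0"
    using nz[of undefined] by (auto simp: column_def zero_vec_def)
  have "(\<Sum>j\<in>UNIV. (norm (column j A))\<^sup>2 / (norm A)\<^sup>2 * (norm (column_step A Z E j))\<^sup>2) =
      (\<Sum>j\<in>UNIV. (norm (column j A))\<^sup>2 / (norm A)\<^sup>2 * (norm E)\<^sup>2 -
        (norm (column j (E ** A)))\<^sup>2 / (norm A)\<^sup>2 + (norm (column j (Z ** A)))\<^sup>2 / (norm A)\<^sup>2)"
    unfolding column_step_def norm_projection_step[OF nz] column_matrix_mult
    using nz by (intro sum.cong refl) (simp add: algebra_simps add_divide_distrib diff_divide_distrib)
  also have "\<dots> = (\<Sum>j\<in>UNIV. (norm (column j A))\<^sup>2 / (norm A)\<^sup>2) * (norm E)\<^sup>2 -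
      (norm (E ** A))\<^sup>2 / (norm A)\<^sup>2 + (norm (Z ** A))\<^sup>2 / (norm A)\<^sup>2"
    unfolding norm_matrix_power2_columns[of "E ** A"] norm_matrix_power2_columns[of "Z ** A"]
    by (simp only: sum.distrib sum_subtractf sum_divide_distrib sum_distrib_right)
  also have "\<dots> = (norm E)\<^sup>2 - (norm (E ** A))\<^sup>2 / (norm A)\<^sup>2 + (norm (Z ** A))\<^sup>2 / (norm A)\<^sup>2"
    by (simp only: sum_column_weights[OF \<open>A \<noteq> 0\<close>] mult_1)
  finally have eq: "(\<Sum>j\<in>UNIV. (norm (column j A))\<^sup>2 / (norm A)\<^sup>2 * (norm (column_step A Z E j))\<^sup>2) =
      (norm E)\<^sup>2 - (norm (E ** A))\<^sup>2 / (norm A)\<^sup>2 + (norm (Z ** A))\<^sup>2 / (norm A)\<^sup>2" .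
  have "s\<^sup>2 * (norm E)\<^sup>2 = (\<Sum>r\<in>UNIV. (s * norm (row r E))\<^sup>2)"
    by (simp add: norm_matrix_power2 sum_distrib_left power_mult_distrib)
  also have "\<dots> \<le> (\<Sum>r\<in>UNIV. (norm (row r (E ** A)))\<^sup>2)"
    unfolding row_matrix_mult using lower \<open>0 \<le> s\<close> by (intro sum_mono power_mono) auto
  also have "\<dots> = (norm (E ** A))\<^sup>2"
    by (simp add: norm_matrix_power2)
  finally have "s\<^sup>2 * (norm E)\<^sup>2 / (norm A)\<^sup>2 \<le> (norm (E ** A))\<^sup>2 / (norm A)\<^sup>2"
    by (rule divide_right_mono) simp
  then show ?thesis
    unfolding eq by (simp add: left_diff_distrib)
qed

section \<open>The error recursions\<close>

lemma outer_minus_left: "outer (- u) v = - outer u v"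
  by (simp add: vec_eq_iff outer_def)

lemma add_to_column_mult: "add_to_column i u Y ** A = Y ** A + outer u (row i A)"
proof -
  have "(\<Sum>l\<in>UNIV. (if l = i then Y $ r $ l + u $ r else Y $ r $ l) * A $ l $ c) =
      (\<Sum>l\<in>UNIV. Y $ r $ l * A $ l $ c + (if l = i then u $ r * A $ l $ c else 0))" for r c
    by (intro sum.cong) (auto simp: distrib_right)
  then show ?thesis
    by (simp add: vec_eq_iff add_to_column_def matrix_matrix_mult_def outer_def row_def sum.distrib)
qed

text \<open>Each update of \<open>R\<close> subtracts exactly what the update of \<open>Y\<close>
  adds to \<open>Y ** A\<close>, so \<open>R\<close> can be eliminated.\<close>

lemma R_iter_eq: "R_iter A C Y0 is k = C - Y_iter A C Y0 is k ** A"
  by (induction k) (simp_all add: add_to_column_mult)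

text \<open>\<open>moore_penrose A ** A\<close> fixes every row of \<open>A\<close>. Hence the row
  updates never see the inconsistent part of \<open>C\<close>.\<close>

lemma residual_moore_penrose:
  fixes A :: "real ^ 'n ^ 'm" and C :: "real ^ 'n ^ 'p"
  shows "(C - (C ** moore_penrose A) ** A) *v row i A = 0"
proof -
  define B where "B = moore_penrose A"
  have B: "A ** B ** A = A" "transpose (B ** A) = B ** A"
    using is_moore_penrose_moore_penrose[of A] by (auto simp: is_moore_penrose_def B_def)
  have "(B ** A) ** transpose A = transpose A"
    by (metis B matrix_mul_assoc matrix_transpose_mul)
  then have "(B ** A) *v row i A = row i A"
    using column_matrix_mult[of i "B ** A" "transpose A"] by simp
  then show ?thesis
    by (simp add: matrix_vector_mult_diff_rdistrib B_def flip: matrix_vector_mul_assoc)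
qed

text \<open>The error is tracked only after multiplication by \<open>A\<close>: the averaged column
  step needs no more, and the rows of the product lie in the row space of \<open>A\<close> whatever
  \<open>Y0\<close> is.\<close>

lemma Y_error_Suc:
  fixes A :: "real ^ 'n ^ 'm" and C :: "real ^ 'n ^ 'p"
  defines "Xs \<equiv> C ** moore_penrose A"
  shows "(Y_iter A C Y0 is (Suc k) - Xs) ** A =
    column_step (transpose A) 0 ((Y_iter A C Y0 is k - Xs) ** A) (is k)"
proof -
  have diff: "(Y - Xs) ** A = Y ** A - Xs ** A" for Y
    by (simp add: matrix_eq matrix_vector_mult_diff_rdistrib flip: matrix_vector_mul_assoc)
  have "R_iter A C Y0 is k *v row (is k) A = - (((Y_iter A C Y0 is k - Xs) ** A) *v row (is k) A)"
    using residual_moore_penrose[of C A "is k"]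
    by (simp add: R_iter_eq Xs_def[symmetric] diff matrix_vector_mult_diff_rdistrib)
  then have "row_coeff A (is k) (R_iter A C Y0 is k) =
      - ((1 / (norm (row (is k) A))\<^sup>2) *\<^sub>R (((Y_iter A C Y0 is k - Xs) ** A) *v row (is k) A))"
    by (simp add: row_coeff_def)
  then show ?thesis
    by (simp add: column_step_def diff add_to_column_mult outer_minus_left)
qed

lemma X_error_Suc:
  "X_iter A C X0 Y0 is js (Suc k) - Xs =
    column_step A (Y_iter A C Y0 is (Suc k) - Xs) (X_iter A C X0 Y0 is js k - Xs) (js k)"
  by (simp add: column_step_def)

text \<open>Column updates change the rows of \<open>X\<close> by multiples of columns of
  \<open>A\<close>, so the column space is never left.\<close>

lemma X_error_rows:
  fixes A :: "real ^ 'n ^ 'm" and C :: "real ^ 'n ^ 'p"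
  assumes X0: "\<And>r. row r X0 \<in> span (columns A)"
  shows "row r (X_iter A C X0 Y0 is js k - C ** moore_penrose A) \<in> range ((*v) A)"
proof -
  define B where "B = moore_penrose A"
  have sub: "subspace (range ((*v) A))"
    by (intro linear_subspace_image subspace_UNIV) simp
  have col: "column j A \<in> range ((*v) A)" for j
    by (metis matrix_vector_mult_basis rangeI)
  then have "columns A \<subseteq> range ((*v) A)"
    by (auto simp: columns_def)
  then have "span (columns A) \<subseteq> range ((*v) A)"
    using sub by (simp add: span_minimal)
  then have X0': "row r X0 \<in> range ((*v) A)"
    using X0 by blast
  \<comment> \<open>Transposing \<open>B = B ** (A ** B)\<close> with \<open>A ** B\<close>
    symmetric puts the rows of \<open>C ** B\<close> in the column space of
    \<open>A\<close>.\<close>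
  have "transpose B = A ** (B ** transpose B)"
    using is_moore_penrose_moore_penrose[of A] unfolding is_moore_penrose_def B_def
    by (metis matrix_mul_assoc matrix_transpose_mul)
  then have "row r (C ** B) = A *v (B ** transpose B *v row r C)"
    unfolding row_matrix_mult by (metis matrix_vector_mul_assoc)
  then have Xs: "row r (C ** B) \<in> range ((*v) A)"
    by blast
  have "row r (X_iter A C X0 Y0 is js k) \<in> range ((*v) A)"
  proof (induction k)
    case (Suc k)
    have "row r (X - outer u v) = row r X - u $ r *\<^sub>R v" for X :: "real ^ 'm ^ 'p" and u v
      by (simp add: vec_eq_iff row_def outer_def)
    then show ?case
      using Suc by (simp only: X_iter.simps) (intro subspace_diff subspace_scale sub col)
  qed (simp add: X0')
  moreover have "row r (X - Y) = row r X - row r Y" for X Y :: "real ^ 'm ^ 'p"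
    by (simp add: vec_eq_iff row_def)
  ultimately show ?thesis
    using Xs sub by (simp add: B_def subspace_diff)
qed

text \<open>Iterate \<open>k\<close> uses only the draws before step \<open>k\<close>; this gives
  its independence of the draw at step \<open>k\<close>.\<close>

lemma Y_iter_cong: "(\<And>l. l < k \<Longrightarrow> is l = is' l) \<Longrightarrow> Y_iter A C Y0 is k = Y_iter A C Y0 is' k"
  by (induction k) (auto simp: R_iter_eq)

lemma X_iter_cong:
  "(\<And>l. l < k \<Longrightarrow> is l = is' l) \<Longrightarrow> (\<And>l. l < k \<Longrightarrow> js l = js' l) \<Longrightarrow>
    X_iter A C X0 Y0 is js k = X_iter A C X0 Y0 is' js' k"
proof (induction k)
  case (Suc k)
  then have "X_iter A C X0 Y0 is js k = X_iter A C X0 Y0 is' js' k"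
    by simp
  with Suc.prems Y_iter_cong[of "Suc k" "is" is' A C Y0] show ?case
    by (simp only: X_iter.simps lessI)
qed simp

section \<open>Averaging over independent selections\<close>

text \<open>\<open>G\<close> takes total families but sees only finitely many coordinates, each with
  finitely many values. It therefore factors through a finite discrete space.\<close>

lemma
  assumes "finite K"
    and G: "\<And>d d'. (\<And>s. s \<in> K \<Longrightarrow> d s = d' s) \<Longrightarrow> G d = (G d' :: real)"
  shows borel_measurable_PiM_finite_fun:
      "G \<in> borel_measurable (PiM K (\<lambda>_. count_space (UNIV :: 'v::finite set)))"
    and bounded_finite_fun: "\<exists>b. \<forall>d. \<bar>G (d :: 'i \<Rightarrow> 'v)\<bar> \<le> b"
proof -
  show "G \<in> borel_measurable (PiM K (\<lambda>_. count_space (UNIV :: 'v set)))"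
    using assms(1) by (subst count_space_PiM_finite) (auto intro: countable_finite)
  have "finite (G ` (PiE K (\<lambda>_. UNIV :: 'v set)))"
    using assms(1) by (intro finite_imageI finite_PiE) auto
  then obtain b where b: "\<forall>x\<in>G ` (PiE K (\<lambda>_. UNIV)). \<bar>x\<bar> \<le> b"
    using bounded_real finite_imp_bounded by metis
  have "\<bar>G d\<bar> \<le> b" for d
  proof -
    have "G d = G (restrict d K)"
      by (rule G) simp
    with b show ?thesis
      by auto
  qed
  then show "\<exists>b. \<forall>d. \<bar>G d\<bar> \<le> b"
    by blast
qed

context prob_space
begin

context
  fixes D :: "'i \<Rightarrow> 'a \<Rightarrow> 'v::finite" and K :: "'i set"
  assumes ind: "indep_vars (\<lambda>_. count_space UNIV) D UNIV" and fin: "finite K"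
begin

lemma integrable_finite_fun:
  fixes G :: "('i \<Rightarrow> 'v) \<Rightarrow> real"
  assumes G: "\<And>d d'. (\<And>s. s \<in> K \<Longrightarrow> d s = d' s) \<Longrightarrow> G d = G d'"
  shows "integrable M (\<lambda>\<omega>. G (\<lambda>s. D s \<omega>))"
proof -
  have D: "D s \<in> measurable M (count_space UNIV)" for s
    using ind by (auto simp: indep_vars_def)
  obtain b where b: "\<And>d. \<bar>G d\<bar> \<le> b"
    using bounded_finite_fun[of K G] G fin by blast
  have "(\<lambda>\<omega>. \<lambda>s\<in>K. D s \<omega>) \<in> measurable M (PiM K (\<lambda>_. count_space UNIV))"
    using D by (intro measurable_restrict) auto
  then have "(\<lambda>\<omega>. G (\<lambda>s\<in>K. D s \<omega>)) \<in> borel_measurable M"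
    using borel_measurable_PiM_finite_fun[OF fin G] by (rule measurable_compose)
  also have "(\<lambda>\<omega>. G (\<lambda>s\<in>K. D s \<omega>)) = (\<lambda>\<omega>. G (\<lambda>s. D s \<omega>))"
    by (intro ext G) simp
  finally show ?thesis
    using b by (intro integrable_const_bound[where B = b]) auto
qed

text \<open>Replaces conditioning on the coordinates in \<open>K\<close>: split by the finitely many
  values of \<open>D t\<close>, factor each term by independence, and reassemble the weighted sum
  under one integral.\<close>

lemma expectation_finite_fun_indep:
  fixes F :: "'v \<Rightarrow> ('i \<Rightarrow> 'v) \<Rightarrow> real"
  assumes t: "t \<notin> K"
    and F: "\<And>v d d'. (\<And>s. s \<in> K \<Longrightarrow> d s = d' s) \<Longrightarrow> F v d = F v d'"
  shows "expectation (\<lambda>\<omega>. F (D t \<omega>) (\<lambda>s. D s \<omega>)) =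
    expectation (\<lambda>\<omega>. \<Sum>v\<in>UNIV. prob {\<omega> \<in> space M. D t \<omega> = v} * F v (\<lambda>s. D s \<omega>))"
proof -
  let ?P = "\<lambda>L. PiM L (\<lambda>_. count_space (UNIV :: 'v set))"
  have D: "D t \<in> measurable M (count_space UNIV)"
    using ind by (auto simp: indep_vars_def)
  have int: "integrable M (\<lambda>\<omega>. F v (\<lambda>s. D s \<omega>))" for v
    by (rule integrable_finite_fun) (rule F)
  have ev: "{\<omega> \<in> space M. D t \<omega> = v} \<in> events" for v
    using D by measurable
  have int_ind: "integrable M (\<lambda>\<omega>. indicator {v} (D t \<omega>) :: real)" for v
    using D by (intro integrable_const_bound[where B = 1]) (auto simp: indicator_def)
  have "expectation (\<lambda>\<omega>. indicator {v} (D t \<omega>) :: real) = expectation (indicator {\<omega> \<in> space M. D t \<omega> = v})" for v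
    by (intro Bochner_Integration.integral_cong) (auto simp: indicator_def)
  then have E_ind: "expectation (\<lambda>\<omega>. indicator {v} (D t \<omega>)) = prob {\<omega> \<in> space M. D t \<omega> = v}" for v
    using ev by simp
  have indep: "indep_var borel (\<lambda>\<omega>. indicator {v} (D t \<omega>) :: real) borel (\<lambda>\<omega>. F v (\<lambda>s. D s \<omega>))" for v
  proof -
    have "indep_var (?P {t}) (\<lambda>\<omega>. \<lambda>s\<in>{t}. D s \<omega>) (?P K) (\<lambda>\<omega>. \<lambda>s\<in>K. D s \<omega>)"
      using t by (intro indep_var_restrict[OF ind]) auto
    then have "indep_var borel ((\<lambda>d. indicator {v} (d t) :: real) \<circ> (\<lambda>\<omega>. \<lambda>s\<in>{t}. D s \<omega>))
        borel (F v \<circ> (\<lambda>\<omega>. \<lambda>s\<in>K. D s \<omega>))"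
      by (rule indep_var_compose) (auto intro: borel_measurable_PiM_finite_fun fin F)
    also have "F v \<circ> (\<lambda>\<omega>. \<lambda>s\<in>K. D s \<omega>) = (\<lambda>\<omega>. F v (\<lambda>s. D s \<omega>))"
      unfolding comp_def by (intro ext F) simp
    finally show ?thesis
      by (simp add: comp_def)
  qed
  have "expectation (\<lambda>\<omega>. F (D t \<omega>) (\<lambda>s. D s \<omega>)) =
      expectation (\<lambda>\<omega>. \<Sum>v\<in>UNIV. indicator {v} (D t \<omega>) * F v (\<lambda>s. D s \<omega>))"
    by (simp add: indicator_def if_distrib[of "\<lambda>x. x * _"] cong: if_cong)
  also have "\<dots> = (\<Sum>v\<in>UNIV. prob {\<omega> \<in> space M. D t \<omega> = v} * expectation (\<lambda>\<omega>. F v (\<lambda>s. D s \<omega>)))"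
    using indep_var_lebesgue_integral[OF indep int_ind int] indep_var_integrable[OF indep int_ind int]
    by (subst Bochner_Integration.integral_sum) (simp_all add: E_ind)
  also have "\<dots> = expectation (\<lambda>\<omega>. \<Sum>v\<in>UNIV. prob {\<omega> \<in> space M. D t \<omega> = v} * F v (\<lambda>s. D s \<omega>))"
    using int by simp
  finally show ?thesis .
qed

end

end

text \<open>Any rate strictly between \<rho> and 1 absorbs the factor \<open>k\<close>. The midpoint
  is also positive when \<rho> is 0, so dividing by it is safe.\<close>

lemma linear_times_geometric_bounded:
  fixes \<rho> a b :: real
  assumes "0 \<le> \<rho>" "\<rho> < 1" "0 \<le> a" "0 \<le> b"
  shows "\<exists>c\<ge>0. \<exists>q. 0 \<le> q \<and> q < 1 \<and> (\<forall>k. (real k * a + b) * \<rho> ^ k \<le> c * q ^ k)"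
proof -
  define q where "q = (1 + \<rho>) / 2"
  have q: "0 < q" "q < 1" "\<rho> < q"
    using assms by (auto simp: q_def)
  then have "norm (\<rho> / q) < 1"
    using assms by simp
  then have "(\<lambda>k. real k * (\<rho> / q) ^ k) \<longlonglongrightarrow> 0"
    by (rule powser_times_n_limit_0)
  then have "Bseq (\<lambda>k. real k * (\<rho> / q) ^ k)"
    using convergent_imp_Bseq convergentI by blast
  then obtain B where B: "0 < B" "\<And>k. real k * (\<rho> / q) ^ k \<le> B"
    by (auto simp: Bseq_def) (metis abs_le_D1)
  have "(real k * a + b) * \<rho> ^ k \<le> (B * a + b) * q ^ k" for k
  proof -
    have "real k * \<rho> ^ k \<le> B * q ^ k"
      using B(2)[of k] q by (simp add: power_divide divide_le_eq)
    then have "a * (real k * \<rho> ^ k) \<le> a * (B * q ^ k)"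
      using assms by (intro mult_left_mono)
    moreover have "b * \<rho> ^ k \<le> b * q ^ k"
      using assms q by (intro mult_left_mono power_mono) auto
    ultimately show ?thesis
      by (simp add: algebra_simps)
  qed
  then show ?thesis
    using q B assms by (intro exI[of _ "B * a + b"] conjI exI[of _ q]) auto
qed

section \<open>The expected errors\<close>

lemma sum_UNIV_Plus:
  fixes f :: "'m::finite + 'n::finite \<Rightarrow> real"
  shows "(\<Sum>v\<in>UNIV. f v) = (\<Sum>i\<in>UNIV. f (Inl i)) + (\<Sum>j\<in>UNIV. f (Inr j))"
  by (simp add: sum.Plus flip: UNIV_Plus_UNIV)

lemma mean_Y_error_le:
  fixes A :: "real ^ 'n ^ 'm" and U :: "real ^ 'm ^ 'p"
  assumes rows: "\<And>i. row i A \<noteq> 0"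
  shows "(\<Sum>i\<in>UNIV. (norm (row i A))\<^sup>2 / (norm A)\<^sup>2 *
      (norm (column_step (transpose A) 0 (U ** A) i))\<^sup>2) \<le>
    (1 - (sigma_min A)\<^sup>2 / (norm A)\<^sup>2) * (norm (U ** A))\<^sup>2"
proof -
  have "A \<noteq> 0"
    using rows[of undefined] by (auto simp: row_def zero_vec_def)
  have "sigma_min A * norm (row r (U ** A)) \<le> norm (transpose (transpose A) *v row r (U ** A))" for r
    unfolding transpose_transpose by (intro sigma_min_le_on_row_space \<open>A \<noteq> 0\<close>) (metis row_matrix_mult rangeI)
  then show ?thesis
    using mean_column_step_le[of "transpose A" "sigma_min A" "U ** A" 0] rows
      sigma_min_pos[OF \<open>A \<noteq> 0\<close>] by (simp add: norm_transpose)
qed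

lemma mean_X_error_le:
  fixes A :: "real ^ 'n ^ 'm" and E Z :: "real ^ 'm ^ 'p"
  assumes columns: "\<And>j. column j A \<noteq> 0" and E: "\<And>r. row r E \<in> range ((*v) A)"
  shows "(\<Sum>j\<in>UNIV. (norm (column j A))\<^sup>2 / (norm A)\<^sup>2 * (norm (column_step A Z E j))\<^sup>2) \<le>
    (1 - (sigma_min A)\<^sup>2 / (norm A)\<^sup>2) * (norm E)\<^sup>2 + (norm (Z ** A))\<^sup>2 / (norm A)\<^sup>2"
proof -
  have "A \<noteq> 0"
    using columns[of undefined] by (auto simp: column_def zero_vec_def)
  show ?thesis
    by (intro mean_column_step_le columns sigma_min_le_on_column_space \<open>A \<noteq> 0\<close> E
        less_imp_le[OF sigma_min_pos])
qed

context
  fixes A :: "real ^ 'n ^ 'm" and C :: "real ^ 'n ^ 'p"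
    and X0 Y0 :: "real ^ 'm ^ 'p" and M :: "'w measure"
    and I :: "nat \<Rightarrow> 'w \<Rightarrow> 'm" and J :: "nat \<Rightarrow> 'w \<Rightarrow> 'n"
  assumes rows: "\<And>i. row i A \<noteq> 0" and columns: "\<And>j. column j A \<noteq> 0"
    and X0: "\<And>r. row r X0 \<in> span (columns A)"
    and prob: "prob_space M" and selection: "random_index_selection M A I J"
begin

interpretation prob_space M
  by (fact prob)

definition contraction :: real where
  "contraction = 1 - (sigma_min A)\<^sup>2 / (norm A)\<^sup>2"

definition Y_error :: "(nat \<Rightarrow> 'm) \<Rightarrow> nat \<Rightarrow> real ^ 'm ^ 'p" where
  "Y_error is k = Y_iter A C Y0 is k - C ** moore_penrose A"

definition X_error :: "(nat \<Rightarrow> 'm) \<Rightarrow> (nat \<Rightarrow> 'n) \<Rightarrow> nat \<Rightarrow> real ^ 'm ^ 'p" where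
  "X_error is js k = X_iter A C X0 Y0 is js k - C ** moore_penrose A"

definition selected :: "nat + nat \<Rightarrow> 'w \<Rightarrow> 'm + 'n" where
  "selected = case_sum (\<lambda>k \<omega>. Inl (I k \<omega>)) (\<lambda>k \<omega>. Inr (J k \<omega>))"

lemma selected_simps [simp]:
  "selected (Inl k) \<omega> = Inl (I k \<omega>)" "selected (Inr k) \<omega> = Inr (J k \<omega>)"
  by (simp_all add: selected_def)

lemma indep_selected: "indep_vars (\<lambda>_. count_space UNIV) selected UNIV"
  using selection by (simp add: random_index_selection_def selected_def)

lemma prob_selected:
  "prob {\<omega> \<in> space M. I k \<omega> = i} = (norm (row i A))\<^sup>2 / (norm A)\<^sup>2"
  "prob {\<omega> \<in> space M. J k \<omega> = j} = (norm (column j A))\<^sup>2 / (norm A)\<^sup>2"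
  using selection by (simp_all add: random_index_selection_def)

text \<open>For arbitrary \<open>d\<close> the projection may meet the wrong summand, where its
  value is unspecified; along \<open>selected\<close> this never happens.\<close>

abbreviation rows_of :: "(nat + nat \<Rightarrow> 'm + 'n) \<Rightarrow> nat \<Rightarrow> 'm" where
  "rows_of d \<equiv> \<lambda>l. projl (d (Inl l))"

abbreviation columns_of :: "(nat + nat \<Rightarrow> 'm + 'n) \<Rightarrow> nat \<Rightarrow> 'n" where
  "columns_of d \<equiv> \<lambda>l. projr (d (Inr l))"

abbreviation up_to :: "nat \<Rightarrow> nat \<Rightarrow> (nat + nat) set" where
  "up_to k l \<equiv> {..<k} <+> {..<l}"

lemma Y_error_cong:
  assumes "k \<le> l" and eq: "\<forall>s\<in>up_to l l'. d s = d' s"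
  shows "Y_error (rows_of d) k = Y_error (rows_of d') k"
proof -
  have "d (Inl n) = d' (Inl n)" if "n < k" for n
    using eq that \<open>k \<le> l\<close> by (auto intro: InlI)
  then show ?thesis
    unfolding Y_error_def by (intro arg_cong2[of _ _ _ _ "(-)"] Y_iter_cong refl) auto
qed

lemma X_error_cong:
  assumes "k \<le> l" "k \<le> l'" and eq: "\<forall>s\<in>up_to l l'. d s = d' s"
  shows "X_error (rows_of d) (columns_of d) k = X_error (rows_of d') (columns_of d') k"
proof -
  have "d (Inl n) = d' (Inl n)" "d (Inr n) = d' (Inr n)" if "n < k" for n
    using eq that \<open>k \<le> l\<close> \<open>k \<le> l'\<close> by (auto intro: InlI InrI)
  then show ?thesis
    unfolding X_error_def by (intro arg_cong2[of _ _ _ _ "(-)"] X_iter_cong refl) auto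
qed

lemma integrable_Y_error: "integrable M (\<lambda>\<omega>. (norm (Y_error (\<lambda>l. I l \<omega>) k ** A))\<^sup>2)"
proof -
  define G where "G d = (norm (Y_error (rows_of d) k ** A))\<^sup>2" for d
  have G: "G d = G d'" if "\<And>s. s \<in> up_to k 0 \<Longrightarrow> d s = d' s" for d d'
    unfolding G_def using Y_error_cong[of k k 0 d d'] that by auto
  have "integrable M (\<lambda>\<omega>. G (\<lambda>s. selected s \<omega>))"
    by (rule integrable_finite_fun[OF indep_selected, of "up_to k 0"]) (auto intro: G)
  then show ?thesis
    by (simp add: G_def)
qed

lemma integrable_X_error: "integrable M (\<lambda>\<omega>. (norm (X_error (\<lambda>l. I l \<omega>) (\<lambda>l. J l \<omega>) k))\<^sup>2)"
proof -
  define G where "G d = (norm (X_error (rows_of d) (columns_of d) k))\<^sup>2" for d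
  have G: "G d = G d'" if "\<And>s. s \<in> up_to k k \<Longrightarrow> d s = d' s" for d d'
    unfolding G_def using X_error_cong[of k k k d d'] that by auto
  have "integrable M (\<lambda>\<omega>. G (\<lambda>s. selected s \<omega>))"
    by (rule integrable_finite_fun[OF indep_selected, of "up_to k k"]) (auto intro: G)
  then show ?thesis
    by (simp add: G_def)
qed

text \<open>The draw of step \<open>k\<close> enters \<open>F\<close> as \<open>v\<close> and the
  earlier draws as \<open>d\<close>. Independence averages over \<open>v\<close> with
  \<open>d\<close> fixed, and the pointwise bound \<open>mean_Y_error_le\<close> is
  integrated.\<close>

lemma expected_Y_error_Suc:
  "expectation (\<lambda>\<omega>. (norm (Y_error (\<lambda>l. I l \<omega>) (Suc k) ** A))\<^sup>2) \<le>
    contraction * expectation (\<lambda>\<omega>. (norm (Y_error (\<lambda>l. I l \<omega>) k ** A))\<^sup>2)"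
proof -
  define F where "F v d = (norm (column_step (transpose A) 0 (Y_error (rows_of d) k ** A) (projl v)))\<^sup>2" for v :: "'m + 'n" and d
  have F: "F v d = F v d'" if "\<And>s. s \<in> up_to k 0 \<Longrightarrow> d s = d' s" for v d d'
    unfolding F_def using Y_error_cong[of k k 0 d d'] that by auto
  define mean where "mean d = (\<Sum>i\<in>UNIV. (norm (row i A))\<^sup>2 / (norm A)\<^sup>2 * F (Inl i) d)" for d
  have "expectation (\<lambda>\<omega>. (norm (Y_error (\<lambda>l. I l \<omega>) (Suc k) ** A))\<^sup>2) =
      expectation (\<lambda>\<omega>. F (selected (Inl k) \<omega>) (\<lambda>s. selected s \<omega>))"
    unfolding F_def Y_error_def Y_error_Suc by simp
  also have "\<dots> = expectation (\<lambda>\<omega>. \<Sum>v\<in>UNIV. prob {\<omega> \<in> space M. selected (Inl k) \<omega> = v} * F v (\<lambda>s. selected s \<omega>))"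
    by (rule expectation_finite_fun_indep[OF indep_selected, of "up_to k 0"]) (auto intro: F)
  also have "\<dots> = expectation (\<lambda>\<omega>. mean (\<lambda>s. selected s \<omega>))"
    \<comment> \<open>A row draw never takes an \<open>Inr\<close> value, so those summands have
      probability 0.\<close>
    by (simp add: mean_def sum_UNIV_Plus prob_selected)
  also have "\<dots> \<le> expectation (\<lambda>\<omega>. contraction * (norm (Y_error (\<lambda>l. I l \<omega>) k ** A))\<^sup>2)"
  proof (rule integral_mono)
    show "integrable M (\<lambda>\<omega>. mean (\<lambda>s. selected s \<omega>))"
      unfolding mean_def
      by (intro Bochner_Integration.integrable_sum integrable_mult_right
          integrable_finite_fun[OF indep_selected, of "up_to k 0"]) (auto intro: F)
    show "mean (\<lambda>s. selected s \<omega>) \<le> contraction * (norm (Y_error (\<lambda>l. I l \<omega>) k ** A))\<^sup>2" for \<omega>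
      unfolding mean_def F_def contraction_def using mean_Y_error_le[OF rows] by simp
  qed (simp add: integrable_Y_error)
  finally show ?thesis
    by simp
qed

lemma expected_X_error_Suc:
  "expectation (\<lambda>\<omega>. (norm (X_error (\<lambda>l. I l \<omega>) (\<lambda>l. J l \<omega>) (Suc k)))\<^sup>2) \<le>
    contraction * expectation (\<lambda>\<omega>. (norm (X_error (\<lambda>l. I l \<omega>) (\<lambda>l. J l \<omega>) k))\<^sup>2) +
    expectation (\<lambda>\<omega>. (norm (Y_error (\<lambda>l. I l \<omega>) (Suc k) ** A))\<^sup>2) / (norm A)\<^sup>2"
proof -
  define F where "F v d = (norm (column_step A (Y_error (rows_of d) (Suc k))
    (X_error (rows_of d) (columns_of d) k) (projr v)))\<^sup>2" for v :: "'m + 'n" and d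
  \<comment> \<open>Column step \<open>k\<close> already uses \<open>Y\<close> at
    \<open>k + 1\<close>, so \<open>k + 1\<close> row draws but only \<open>k\<close> column draws
    are held fixed.\<close>
  have F: "F v d = F v d'" if "\<And>s. s \<in> up_to (Suc k) k \<Longrightarrow> d s = d' s" for v d d'
    unfolding F_def using Y_error_cong[of "Suc k" "Suc k" k d d'] X_error_cong[of k "Suc k" k d d'] that by auto
  define mean where "mean d = (\<Sum>j\<in>UNIV. (norm (column j A))\<^sup>2 / (norm A)\<^sup>2 * F (Inr j) d)" for d
  have "expectation (\<lambda>\<omega>. (norm (X_error (\<lambda>l. I l \<omega>) (\<lambda>l. J l \<omega>) (Suc k)))\<^sup>2) =
      expectation (\<lambda>\<omega>. F (selected (Inr k) \<omega>) (\<lambda>s. selected s \<omega>))"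
    unfolding F_def X_error_def Y_error_def X_error_Suc by simp
  also have "\<dots> = expectation (\<lambda>\<omega>. \<Sum>v\<in>UNIV. prob {\<omega> \<in> space M. selected (Inr k) \<omega> = v} * F v (\<lambda>s. selected s \<omega>))"
    by (rule expectation_finite_fun_indep[OF indep_selected, of "up_to (Suc k) k"]) (auto intro: F)
  also have "\<dots> = expectation (\<lambda>\<omega>. mean (\<lambda>s. selected s \<omega>))"
    by (simp add: mean_def sum_UNIV_Plus prob_selected)
  also have "\<dots> \<le> expectation (\<lambda>\<omega>. contraction * (norm (X_error (\<lambda>l. I l \<omega>) (\<lambda>l. J l \<omega>) k))\<^sup>2 +
      (norm (Y_error (\<lambda>l. I l \<omega>) (Suc k) ** A))\<^sup>2 / (norm A)\<^sup>2)"
  proof (rule integral_mono)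
    show "integrable M (\<lambda>\<omega>. mean (\<lambda>s. selected s \<omega>))"
      unfolding mean_def
      by (intro Bochner_Integration.integrable_sum integrable_mult_right
          integrable_finite_fun[OF indep_selected, of "up_to (Suc k) k"]) (auto intro: F)
    show "mean (\<lambda>s. selected s \<omega>) \<le> contraction * (norm (X_error (\<lambda>l. I l \<omega>) (\<lambda>l. J l \<omega>) k))\<^sup>2 +
        (norm (Y_error (\<lambda>l. I l \<omega>) (Suc k) ** A))\<^sup>2 / (norm A)\<^sup>2" for \<omega>
    proof -
      have "row r (X_error (\<lambda>l. I l \<omega>) (\<lambda>l. J l \<omega>) k) \<in> range ((*v) A)" for r
        unfolding X_error_def by (rule X_error_rows[OF X0])
      from mean_X_error_le[OF columns this] show ?thesis
        unfolding mean_def F_def contraction_def by simp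
    qed
  qed (simp add: integrable_Y_error integrable_X_error)
  also have "\<dots> = contraction * expectation (\<lambda>\<omega>. (norm (X_error (\<lambda>l. I l \<omega>) (\<lambda>l. J l \<omega>) k))\<^sup>2) +
      expectation (\<lambda>\<omega>. (norm (Y_error (\<lambda>l. I l \<omega>) (Suc k) ** A))\<^sup>2) / (norm A)\<^sup>2"
    by (simp add: integrable_Y_error integrable_X_error)
  finally show ?thesis .
qed

lemma contraction_bounds: "0 \<le> contraction" "contraction < 1"
proof -
  have "A \<noteq> 0"
    using rows[of undefined] by (auto simp: row_def zero_vec_def)
  then have "0 < sigma_min A" "sigma_min A \<le> norm A"
    by (simp_all add: sigma_min_pos sigma_min_le_norm)
  then show "0 \<le> contraction" "contraction < 1"
    using \<open>A \<noteq> 0\<close> by (simp_all add: contraction_def divide_le_eq_1 power_mono)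
qed

lemma expected_Y_error_le:
  "expectation (\<lambda>\<omega>. (norm (Y_error (\<lambda>l. I l \<omega>) k ** A))\<^sup>2) \<le>
    contraction ^ k * (norm ((Y0 - C ** moore_penrose A) ** A))\<^sup>2"
proof (induction k)
  case 0
  then show ?case
    by (simp add: Y_error_def prob_space)
next
  case (Suc k)
  then show ?case
    using expected_Y_error_Suc[of k] mult_left_mono[OF Suc contraction_bounds(1)]
    by (simp add: mult.assoc)
qed

text \<open>The perturbation entering at step \<open>k\<close> is at most a multiple of
  \<open>contraction ^ Suc k\<close>, and all earlier ones have by then been contracted to the same
  power. Their equal contributions add up to the factor \<open>k\<close>.\<close>

lemma expected_X_error_le:
  "expectation (\<lambda>\<omega>. (norm (X_error (\<lambda>l. I l \<omega>) (\<lambda>l. J l \<omega>) k))\<^sup>2) \<le>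
    real k * contraction ^ k / (norm A)\<^sup>2 * (norm ((Y0 - C ** moore_penrose A) ** A))\<^sup>2 +
    contraction ^ k * (norm (X0 - C ** moore_penrose A))\<^sup>2"
    (is "?E k \<le> real k * _ / _ * ?y + _ * ?x")
proof (induction k)
  case 0
  then show ?case
    by (simp add: X_error_def prob_space)
next
  case (Suc k)
  have "?E (Suc k) \<le> contraction * ?E k + contraction ^ Suc k * ?y / (norm A)\<^sup>2"
    using expected_X_error_Suc[of k] divide_right_mono[OF expected_Y_error_le[of "Suc k"], of "(norm A)\<^sup>2"]
    by simp
  also have "\<dots> \<le> contraction * (real k * contraction ^ k / (norm A)\<^sup>2 * ?y + contraction ^ k * ?x) +
      contraction ^ Suc k * ?y / (norm A)\<^sup>2"
    using mult_left_mono[OF Suc contraction_bounds(1)] by simp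
  also have "\<dots> = real (Suc k) * contraction ^ Suc k / (norm A)\<^sup>2 * ?y + contraction ^ Suc k * ?x"
    by (simp add: algebra_simps add_divide_distrib)
  finally show ?case .
qed

end

theorem theorem4p6:
  fixes A :: "real ^ 'n ^ 'm" and C :: "real ^ 'n ^ 'p"
    and X0 Y0 :: "real ^ 'm ^ 'p"
    and M :: "'w measure"
    and I :: "nat \<Rightarrow> 'w \<Rightarrow> 'm" and J :: "nat \<Rightarrow> 'w \<Rightarrow> 'n"
    and X :: "nat \<Rightarrow> 'w \<Rightarrow> real ^ 'm ^ 'p" and Xstar :: "real ^ 'm ^ 'p" and \<rho> :: real
  assumes no_zero_row: "\<And>i. row i A \<noteq> 0"
    and no_zero_column: "\<And>j. column j A \<noteq> 0"
    and X0_rows: "\<And>r. row r X0 \<in> span (columns A)"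
    and prob: "prob_space M"
    and selection: "random_index_selection M A I J"
    and X_eq: "X = (\<lambda>k \<omega>. X_iter A C X0 Y0 (\<lambda>l. I l \<omega>) (\<lambda>l. J l \<omega>) k)"
    and Xstar_eq: "Xstar = C ** moore_penrose A"
    and rho_eq: "\<rho> = 1 - (sigma_min A)\<^sup>2 / (norm A)\<^sup>2"
  shows "converges_linearly_in_mean_square M X Xstar \<and>
    (\<forall>k. prob_space.expectation M (\<lambda>\<omega>. (norm (X (k + 1) \<omega> - Xstar))\<^sup>2)
       \<le> (real k + 1) * \<rho> ^ (k + 1) / (norm A)\<^sup>2 * (norm (Y0 ** A - Xstar ** A))\<^sup>2
         + \<rho> ^ (k + 1) * (norm (X0 - Xstar))\<^sup>2)"
proof -
  note setting = no_zero_row no_zero_column X0_rows prob selection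
  have diff: "(Y0 - Xstar) ** A = Y0 ** A - Xstar ** A"
    by (simp add: matrix_eq matrix_vector_mult_diff_rdistrib flip: matrix_vector_mul_assoc)
  have int: "integrable M (\<lambda>\<omega>. (norm (X k \<omega> - Xstar))\<^sup>2)" for k
    using integrable_X_error[OF setting, of C Y0 k] by (simp add: X_error_def[OF setting] X_eq Xstar_eq)
  have bound: "(\<integral>\<omega>. (norm (X k \<omega> - Xstar))\<^sup>2 \<partial>M) \<le>
      real k * \<rho> ^ k / (norm A)\<^sup>2 * (norm (Y0 ** A - Xstar ** A))\<^sup>2 + \<rho> ^ k * (norm (X0 - Xstar))\<^sup>2" for k
    using expected_X_error_le[OF setting, of C Y0 k] diff
    by (simp add: X_error_def[OF setting] contraction_def[OF setting] X_eq Xstar_eq rho_eq)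
  have rho: "0 \<le> \<rho>" "\<rho> < 1"
    using contraction_bounds[OF setting] by (simp_all add: contraction_def[OF setting] rho_eq)
  obtain c q where "0 \<le> c" "0 \<le> q" "q < 1" and geom: "\<And>k.
      (real k * ((norm (Y0 ** A - Xstar ** A))\<^sup>2 / (norm A)\<^sup>2) + (norm (X0 - Xstar))\<^sup>2) * \<rho> ^ k \<le> c * q ^ k"
    using linear_times_geometric_bounded[OF rho, of "(norm (Y0 ** A - Xstar ** A))\<^sup>2 / (norm A)\<^sup>2"
        "(norm (X0 - Xstar))\<^sup>2"] by auto
  have "(\<integral>\<omega>. (norm (X k \<omega> - Xstar))\<^sup>2 \<partial>M) \<le> c * q ^ k" for k
    using bound[of k] geom[of k] by (simp add: algebra_simps)
  then have "converges_linearly_in_mean_square M X Xstar"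
    unfolding converges_linearly_in_mean_square_def
    using int \<open>0 \<le> c\<close> \<open>0 \<le> q\<close> \<open>q < 1\<close> by blast
  moreover have "\<forall>k. prob_space.expectation M (\<lambda>\<omega>. (norm (X (k + 1) \<omega> - Xstar))\<^sup>2)
      \<le> (real k + 1) * \<rho> ^ (k + 1) / (norm A)\<^sup>2 * (norm (Y0 ** A - Xstar ** A))\<^sup>2
        + \<rho> ^ (k + 1) * (norm (X0 - Xstar))\<^sup>2"
    using bound[of "k + 1" for k] by (simp add: add.commute)
  ultimately show ?thesis
    by blast
qed

end
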